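(* Let $\mathcal{X}$ and $\mathcal{Y}$ be non-empty finite sets. There exists a function $$\nu : (1/2,\infty)\times(0,\infty)\times(0,\infty)\times(0,1)\to\mathbb{Z}_{\ge 0}$$ such that the following holds. If $\alpha > 1/2$, $\beta > 0$, $\alpha+\beta < 1$, $\epsilon > 0$, $0 < \delta < 1$, $p$ is a probability mass function on $\mathcal{X}$, $w$ is a transition function from $\mathcal{X}$ to $\mathcal{Y}$, $S$ is a training set of $n \ge \nu(\alpha,\beta,\epsilon,\delta)$ ($n$ a positive integer) i.i.d. pairs with distribution $p\times w$, and the $(\alpha,\beta)$-VSEE algorithm returns $(K,R)$ for the input $S$, then $$\Pr[\, I(p,w)-\epsilon \le R \le I_{\mathrm{LM}}(p,w,K)\,] > 1-\delta .$$
   Context: A transition function $w$ from $\mathcal{X}$ to $\mathcal{Y}$ assigns to each $x \in \mathcal{X}$ a probability mass function (PMF) $w(\cdot|x)$ on $\mathcal{Y}$. For a PMF $p$ on $\mathcal{X}$, $pw$ is the PMF on $\mathcal{Y}$ given by $pw(y) = \sum_{x} p(x) w(y|x)$; $p \times w$ is the PMF on $\mathcal{X}\times\mathcal{Y}$ given by $(p\times w)(x,y) = p(x)w(y|x)$; $I(p,w)$ is the mutual information, in bits, between $X$ and $Y$ when $(X,Y)\sim p\times w$. A decoding metric is a function $k : \mathcal{X}\times\mathcal{Y}\to[0,\infty)$. The LM rate is $$I_{\mathrm{LM}}(p,w,k) = \min_{\tilde w \in \tilde W(p,w)} I(p,\tilde w),$$ where $\tilde W(p,w)$ is the set of transition functions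 $\tilde w$ from $\mathcal{X}$ to $\mathcal{Y}$ with $p\tilde w = pw$ and $$E_{(X,Y)\sim p\times\tilde w}\log_2 k(X,Y) \ge E_{(X,Y)\sim p\times w}\log_2 k(X,Y),$$ with the conventions $\log_2 0 = -\infty$ and $0\cdot(-\infty)=0$. For a finite sequence $\mathbf{x}$, $N(x|\mathbf{x})$ is the number of occurrences of the symbol $x$ in $\mathbf{x}$. For a sequence $\mathbf{x}$ of length $n$ and an alphabet size $l$, the Miller–Madow corrected entropy estimate is $$\hat H_{\mathrm{MM}}(\mathbf{x},l) = -\sum_{x:\,N(x|\mathbf{x})>0}\frac{N(x|\mathbf{x})}{n}\log_2\left(\frac{N(x|\mathbf{x})}{n}\right) + \frac{l-1}{2n}\log_2(e).$$ A training set of size $n$ is a sequence $s\in(\mathcal{X}\times\mathcal{Y})^n$. For $\alpha,\beta\in\mathbb{R}$, the $(\alpha,\beta)$-VSEE (virtual sample and entropy estimation) algorithm, on input $s=\{(x_i,y_i)\}_{i=1}^n\in(\mathcal{X}\times\mathcal{Y})^n$ with $n$ a positive integer, returns the pair $(k,\hat I - n^{-\beta})$, where $k(x,y) = N(x,y|s)+n^{\alpha}$ for all $x\in\mathcal{X}$, $y\in\mathcal{Y}$ ($N(x,y|s)$ being the number of occurrences of $(x,y)$ in $s$), and $$\hat I = \hat H_{\mathrm{MM}}(\{x_i\}_{i=1}^n,|\mathcal{X}|) + \hat H_{\mathrm{MM}}(\{y_i\}_{i=1}^n,|\mathcal{Y}|) - \hat H_{\mathrm{MM}}(s,|\mathcal{X}||\mathcal{Y}|).$$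 *)

theory Defs
  imports "HOL-Probability.Probability"
begin

text \<open>A transition function from \<open>'x\<close> to \<open>'y\<close> is a map of type \<open>'x \<Rightarrow> 'y pmf\<close>; the PMF \<open>pw\<close> on
  \<open>'y\<close> is then \<open>bind_pmf p w\<close>.\<close>

definition joint_pmf :: "'x pmf \<Rightarrow> ('x \<Rightarrow> 'y pmf) \<Rightarrow> ('x \<times> 'y) pmf" where
  "joint_pmf p w = bind_pmf p (\<lambda>x. map_pmf (Pair x) (w x))"

definition mutual_info :: "'x pmf \<Rightarrow> ('x \<Rightarrow> 'y pmf) \<Rightarrow> real" where
  "mutual_info p w =
     prob_space.mutual_information (measure_pmf (joint_pmf p w)) 2
       (count_space UNIV) (count_space UNIV) fst snd"

text \<open>Decoding metrics take values in \<open>[0, \<infinity>)\<close>; the value at a negative argument is irrelevant.\<close>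

definition log2_ext :: "real \<Rightarrow> ereal" where
  "log2_ext t = (if t = 0 then -\<infinity> else ereal (log 2 t))"

text \<open>On \<open>ereal\<close>, \<open>0 * (-\<infinity>) = 0\<close>, and no summand below is \<open>+\<infinity>\<close>.\<close>

definition expected_log_metric ::
  "'x::finite pmf \<Rightarrow> ('x \<Rightarrow> 'y::finite pmf) \<Rightarrow> ('x \<Rightarrow> 'y \<Rightarrow> real) \<Rightarrow> ereal" where
  "expected_log_metric p w k =
     (\<Sum>(x, y)\<in>UNIV. ereal (pmf (joint_pmf p w) (x, y)) * log2_ext (k x y))"

definition LM_transitions ::
  "'x::finite pmf \<Rightarrow> ('x \<Rightarrow> 'y::finite pmf) \<Rightarrow> ('x \<Rightarrow> 'y \<Rightarrow> real) \<Rightarrow> ('x \<Rightarrow> 'y pmf) set" where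
  "LM_transitions p w k =
     {v. bind_pmf p v = bind_pmf p w \<and> expected_log_metric p v k \<ge> expected_log_metric p w k}"

text \<open>The infimum is a minimum; see \<open>LM_rate_attained\<close> below.\<close>

definition LM_rate ::
  "'x::finite pmf \<Rightarrow> ('x \<Rightarrow> 'y::finite pmf) \<Rightarrow> ('x \<Rightarrow> 'y \<Rightarrow> real) \<Rightarrow> real" where
  "LM_rate p w k = (INF v\<in>LM_transitions p w k. mutual_info p v)"

text \<open>Miller--Madow corrected entropy estimate, in bits, for an alphabet of size \<open>l\<close>.\<close>

definition H_MM :: "'a list \<Rightarrow> nat \<Rightarrow> real" where
  "H_MM xs l =
     - (\<Sum>a\<in>{a. count_list xs a > 0}.
          real (count_list xs a) / real (length xs) *
          log 2 (real (count_list xs a) / real (length xs)))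
     + (real l - 1) / (2 * real (length xs)) * log 2 (exp 1)"

definition VSEE ::
  "real \<Rightarrow> real \<Rightarrow> ('x::finite \<times> 'y::finite) list \<Rightarrow> ('x \<Rightarrow> 'y \<Rightarrow> real) \<times> real" where
  "VSEE \<alpha> \<beta> s =
     (let n = real (length s);
          k = (\<lambda>x y. real (count_list s (x, y)) + n powr \<alpha>);
          I = H_MM (map fst s) CARD('x) + H_MM (map snd s) CARD('y)
              - H_MM s (CARD('x) * CARD('y))
      in (k, I - n powr (- \<beta>)))"

lemma pmf_joint: "pmf (joint_pmf p w) (x, y) = pmf p x * pmf (w x) y"
proof -
  have "pmf (map_pmf (Pair x') (w x')) (x, y) = pmf (w x) y * indicator {x} x'" for x'
  proof (cases "x' = x")
    case True
    then show ?thesis by (simp add: pmf_map_inj' inj_def)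
  next
    case False
    then show ?thesis by (auto simp: pmf_eq_0_set_pmf)
  qed
  then have "pmf (joint_pmf p w) (x, y) = measure_pmf.expectation p (\<lambda>x'. pmf (w x) y * indicator {x} x')"
    by (simp only: joint_pmf_def pmf_bind)
  then show ?thesis
    by (simp add: pmf.rep_eq mult.commute)
qed

lemma pmf_out: "pmf (bind_pmf p w) y = (\<Sum>x\<in>UNIV. pmf p x * pmf (w x) y)"
  for p :: "'x::finite pmf"
  by (simp add: pmf_bind integral_measure_pmf_real[of UNIV] mult.commute)

lemma map_fst_joint: "map_pmf fst (joint_pmf p w) = p"
  by (simp add: joint_pmf_def map_bind_pmf pmf.map_comp o_def bind_return_pmf')

lemma map_snd_joint: "map_pmf snd (joint_pmf p w) = bind_pmf p w"
  by (simp add: joint_pmf_def map_bind_pmf pmf.map_comp o_def)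

lemma mutual_info_eq:
  fixes p :: "'x::finite pmf" and w :: "'x \<Rightarrow> 'y::finite pmf"
  shows "mutual_info p w =
    (\<Sum>x\<in>UNIV. \<Sum>y\<in>UNIV. pmf p x * pmf (w x) y * log 2 (pmf (w x) y / pmf (bind_pmf p w) y))"
proof -
  let ?J = "joint_pmf p w"
  interpret information_space "measure_pmf ?J" 2
    by unfold_locales simp
  have sd: "simple_distributed (measure_pmf ?J) f (pmf (map_pmf f ?J))" for f :: "'x \<times> 'y \<Rightarrow> 'c"
    by (rule measure_pmf.simple_distributedI) (simp_all add: simple_function_def pmf_map)
  have "mutual_info p w = (\<Sum>(x, y)\<in>(\<lambda>z. (fst z, snd z)) ` space (measure_pmf ?J).
      pmf ?J (x, y) * log 2 (pmf ?J (x, y) / (pmf p x * pmf (bind_pmf p w) y)))"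
    using mutual_information_simple_distributed[OF sd[of fst] sd[of snd] sd[of "\<lambda>z. (fst z, snd z)"]]
    by (simp add: mutual_info_def map_fst_joint map_snd_joint)
  also have "\<dots> = (\<Sum>x\<in>UNIV. \<Sum>y\<in>UNIV. pmf ?J (x, y) * log 2 (pmf ?J (x, y) / (pmf p x * pmf (bind_pmf p w) y)))"
    by (simp add: sum.cartesian_product)
  also have "\<dots> = (\<Sum>x\<in>UNIV. \<Sum>y\<in>UNIV. pmf p x * pmf (w x) y * log 2 (pmf (w x) y / pmf (bind_pmf p w) y))"
    by (intro sum.cong refl) (simp add: pmf_joint)
  finally show ?thesis .
qed

lemma LM_transitions_self: "w \<in> LM_transitions p w k"
  by (simp add: LM_transitions_def)

lemma expected_log_metric_eq:
  "expected_log_metric p w k =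
    (if \<exists>x y. pmf p x * pmf (w x) y > 0 \<and> k x y = 0 then -\<infinity>
     else ereal (\<Sum>x\<in>UNIV. \<Sum>y\<in>UNIV. pmf p x * pmf (w x) y * log 2 (k x y)))"
proof (cases "\<exists>x y. pmf p x * pmf (w x) y > 0 \<and> k x y = 0")
  case True
  then obtain x y where xy: "pmf p x * pmf (w x) y > 0" "k x y = 0" by blast
  let ?f = "\<lambda>(x, y). ereal (pmf (joint_pmf p w) (x, y)) * log2_ext (k x y)"
  have np: "?f z \<noteq> \<infinity>" for z
    by (cases z) (auto simp: log2_ext_def)
  have "?f (x, y) = -\<infinity>" using xy by (auto simp: log2_ext_def pmf_joint)
  then have "sum ?f UNIV = -\<infinity> + sum ?f (UNIV - {(x, y)})"
    using sum.remove[of UNIV "(x, y)" ?f] by (simp only: finite UNIV_I)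
  also have "\<dots> = -\<infinity>" using np by (simp add: sum_Pinfty)
  finally show ?thesis using True by (simp add: expected_log_metric_def)
next
  case False
  have "ereal (pmf (joint_pmf p w) (x, y)) * log2_ext (k x y) =
      ereal (pmf p x * pmf (w x) y * log 2 (k x y))" for x y
  proof (cases "k x y = 0")
    case True
    then have "\<not> 0 < pmf p x * pmf (w x) y" using False by blast
    then have "pmf p x * pmf (w x) y = 0"
      using mult_nonneg_nonneg[OF pmf_nonneg[of p x] pmf_nonneg[of "w x" y]] by linarith
    then show ?thesis by (simp only: pmf_joint) (simp add: log2_ext_def zero_ereal_def[symmetric])
  qed (simp add: log2_ext_def pmf_joint)
  then have "expected_log_metric p w k = (\<Sum>(x, y)\<in>UNIV. ereal (pmf p x * pmf (w x) y * log 2 (k x y)))"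
    by (simp add: expected_log_metric_def)
  also have "\<dots> = ereal (\<Sum>x\<in>UNIV. \<Sum>y\<in>UNIV. pmf p x * pmf (w x) y * log 2 (k x y))"
    by (simp add: sum.cartesian_product split_def)
  finally show ?thesis using False by simp
qed

lemma continuous_on_mult_log:
  assumes "0 \<le> m"
  shows "continuous_on {0..} (\<lambda>t::real. t * log 2 (t / m))"
proof (cases "m = 0")
  case False
  with assms have m: "m > 0" by simp
  have "((\<lambda>t::real. t * log 2 (t / m)) \<longlongrightarrow> a * log 2 (a / m)) (at a within {0..})" if "a \<ge> 0" for a
  proof (cases "a = 0")
    case True
    have "((\<lambda>t::real. t * log 2 (t / m)) \<longlongrightarrow> 0) (at_right 0)"
      using m unfolding log_def by real_asymp
    moreover have "at (0::real) within {0..} = at_right 0"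
    proof -
      have "{0..} - {0::real} = {0<..} - {0}" by auto
      then show ?thesis by (metis at_within_def)
    qed
    ultimately show ?thesis using True by simp
  next
    case False
    then show ?thesis using m that
      by (intro tendsto_intros) auto
  qed
  then show ?thesis by (simp add: continuous_on_def)
qed (simp add: continuous_on_mult_right continuous_on_id)

text \<open>The minimum defining the LM rate exists, so the infimum in \<open>LM_rate_def\<close> is that minimum.\<close>

lemma LM_rate_attained:
  fixes p :: "'x::finite pmf" and w :: "'x \<Rightarrow> 'y::finite pmf"
  shows "\<exists>v\<in>LM_transitions p w k.
    LM_rate p w k = mutual_info p v \<and> (\<forall>u\<in>LM_transitions p w k. mutual_info p v \<le> mutual_info p u)"
proof -
  define m where "m y = pmf (bind_pmf p w) y" for y
  define vec :: "('x \<Rightarrow> 'y pmf) \<Rightarrow> real ^ ('x \<times> 'y)" where "vec v = (\<chi> z. pmf (v (fst z)) (snd z))" for v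
  have vec: "vec v $ (x, y) = pmf (v x) y" for v x y by (simp add: vec_def)
  let ?P = "{q :: real ^ ('x \<times> 'y). (\<forall>z. 0 \<le> q $ z) \<and> (\<forall>x. (\<Sum>y\<in>UNIV. q $ (x, y)) = 1)}"
  let ?M = "{q :: real ^ ('x \<times> 'y). \<forall>y. (\<Sum>x\<in>UNIV. pmf p x * q $ (x, y)) = m y}"
  define c where "c = (\<Sum>x\<in>UNIV. \<Sum>y\<in>UNIV. pmf p x * pmf (w x) y * log 2 (k x y))"
  let ?E = "{q :: real ^ ('x \<times> 'y). (\<forall>x y. k x y = 0 \<longrightarrow> pmf p x * q $ (x, y) \<le> 0) \<and>
     c \<le> (\<Sum>x\<in>UNIV. \<Sum>y\<in>UNIV. pmf p x * q $ (x, y) * log 2 (k x y))}"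
  define E where "E = (if expected_log_metric p w k = -\<infinity> then UNIV else ?E)"
  define C where "C = ?P \<inter> ?M \<inter> E"
  have "closed ?P" "closed ?M" "closed ?E"
    by (intro closed_Collect_conj closed_Collect_all closed_Collect_imp closed_Collect_le
        closed_Collect_eq open_Collect_const continuous_intros)+
  then have "closed C" by (auto simp: C_def E_def)
  moreover have "bounded C"
  proof -
    have "norm q \<le> real CARD('x \<times> 'y)" if "q \<in> C" for q
    proof -
      have q: "\<And>z. 0 \<le> q $ z" "\<And>x. (\<Sum>y\<in>UNIV. q $ (x, y)) = 1" using that by (auto simp: C_def)
      have "\<bar>q $ (x, y)\<bar> \<le> 1" for x y
        using q(1) member_le_sum[of y UNIV "\<lambda>y. q $ (x, y)"] by (simp add: q(2))
      then have "(\<Sum>z\<in>UNIV. \<bar>q $ z\<bar>) \<le> (\<Sum>z\<in>(UNIV :: ('x \<times> 'y) set). 1)"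
        by (intro sum_mono) auto
      with norm_le_l1_cart[of q] show ?thesis by simp
    qed
    then show ?thesis by (auto simp: bounded_iff)
  qed
  ultimately have "compact C" by (simp add: compact_eq_bounded_closed)
  have mem: "vec v \<in> C \<longleftrightarrow> v \<in> LM_transitions p w k" for v
  proof -
    have P: "vec v \<in> ?P" by (auto simp: vec_def sum_pmf_eq_1)
    have M: "vec v \<in> ?M \<longleftrightarrow> bind_pmf p v = bind_pmf p w"
      by (auto simp: vec m_def pmf_eq_iff pmf_out[of p v])
    have "vec v \<in> E \<longleftrightarrow> expected_log_metric p v k \<ge> expected_log_metric p w k"
      by (auto simp: E_def c_def vec expected_log_metric_eq not_le not_less)
    with P M show ?thesis by (auto simp: C_def LM_transitions_def)
  qed
  have ex: "\<exists>v. q = vec v" if "q \<in> C" for q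
  proof -
    have q: "\<And>z. 0 \<le> q $ z" "\<And>x. (\<Sum>y\<in>UNIV. q $ (x, y)) = 1" using that by (auto simp: C_def)
    define v where "v x = embed_pmf (\<lambda>y. q $ (x, y))" for x
    have "pmf (v x) y = q $ (x, y)" for x y
      unfolding v_def using q
      by (subst pmf_embed_pmf) (auto simp: nn_integral_count_space_finite sum_ennreal)
    then have "q = vec v" by (simp add: vec_def vec_eq_iff)
    then show ?thesis by blast
  qed
  define f where "f q = (\<Sum>x\<in>UNIV. \<Sum>y\<in>UNIV. pmf p x * (q $ (x, y) * log 2 (q $ (x, y) / m y)))"
    for q :: "real ^ ('x \<times> 'y)"
  have f: "f (vec v) = mutual_info p v" if "v \<in> LM_transitions p w k" for v
    using that by (simp add: f_def vec mutual_info_eq LM_transitions_def m_def mult.assoc)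
  have "continuous_on C f"
    unfolding f_def
    by (intro continuous_intros continuous_on_compose2[OF continuous_on_mult_log])
      (auto simp: m_def C_def)
  moreover have "C \<noteq> {}" using mem[of w] LM_transitions_self[of w p k] by auto
  ultimately obtain q where q: "q \<in> C" "\<And>r. r \<in> C \<Longrightarrow> f q \<le> f r"
    using continuous_attains_inf[OF \<open>compact C\<close>] by blast
  from ex[OF q(1)] obtain v where v: "q = vec v" by blast
  have vm: "v \<in> LM_transitions p w k" using q(1) v mem by simp
  have min: "mutual_info p v \<le> mutual_info p u" if "u \<in> LM_transitions p w k" for u
    using q(2)[of "vec u"] that mem f vm v by simp
  have "LM_rate p w k = mutual_info p v"
    unfolding LM_rate_def using vm min by (intro cInf_eq_minimum) auto
  with vm min show ?thesis by blast
qed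

end

theory Submission
  imports Defs
begin

text \<open>
  Write \<open>q = p \<times> w\<close>, \<open>e\<close> for the empirical distribution and \<open>\<eta> = n powr (\<alpha> - 1)\<close>, so that
  \<open>K = n (e + \<eta>)\<close>. Since \<open>\<alpha> > 1/2\<close>, Hoeffding's inequality gives \<open>\<bar>e - q\<bar> < \<eta>\<close> everywhere with
  probability close to 1, uniformly in \<open>q\<close>. Then \<open>e + \<eta>\<close> dominates \<open>q\<close>, and for a competitor
  \<open>v\<close> with joint distribution \<open>r = p \<times> v\<close>, Gibbs' inequality against the unnormalised
  \<open>e + \<eta>\<close> (of total mass \<open>1 + m \<eta>\<close>, where \<open>m = |X| |Y|\<close>) gives
  \<open>-H(r) \<ge> E\<^sub>r ln (e + \<eta>) - m \<eta> \<ge> E\<^sub>q ln (e + \<eta>) - m \<eta> \<ge> -H(q) - m \<eta>\<close>. As \<open>r\<close> and \<open>q\<close> have the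
  same marginals, the LM rate is at least \<open>I(p, w) - O(\<eta>)\<close>. On the same event the estimate of the
  mutual information is off by \<open>O(\<eta> powr \<theta>)\<close> for every \<open>\<theta> < 1\<close>, by Hoelder continuity of
  \<open>t ln t\<close>. Choosing \<open>\<theta> > \<beta> / (1 - \<alpha>)\<close>, the margin \<open>n powr (-\<beta>)\<close> absorbs both errors.
\<close>

section \<open>Hoelder continuity of t ln t and of the entropy\<close>

text \<open>For \<open>a \<le> b\<close> and \<open>t = b - a\<close>, the difference
  \<open>b ln b - a ln a\<close> splits as \<open>t ln b + a (ln b - ln a)\<close>. The first
  summand lies between \<open>t ln t\<close> and 0, the second between 0 and \<open>t\<close>, so
  the whole lies between \<open>t ln t\<close> and \<open>t\<close>; both ends are
  \<open>O(t powr \<theta>)\<close>.\<close>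

lemma abs_diff_mult_ln_le:
  fixes a b d \<theta> :: real
  assumes "0 \<le> a" "a \<le> 1" "0 \<le> b" "b \<le> 1" "\<bar>a - b\<bar> \<le> d" "d \<le> 1" "0 < \<theta>" "\<theta> < 1"
  shows "\<bar>a * ln a - b * ln b\<bar> \<le> d powr \<theta> / (1 - \<theta>)"
  using assms(1-5)
proof (induction a b rule: linorder_wlog)
  case (sym a b)
  then show ?case by (simp add: abs_minus_commute)
next
  case (le a b)
  define t where "t = b - a"
  show ?case
  proof (cases "t = 0")
    case True
    then show ?thesis using assms by (simp add: t_def)
  next
    case False
    with le have t: "0 < t" "t \<le> d" "t \<le> b" "0 < b" "t \<le> 1" by (auto simp: t_def)
    \<comment> \<open>Since \<open>1 / (1 - \<theta>) \<ge> 1\<close>, one constant serves for the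
      upper and the lower estimate.\<close>
    have tpow: "t powr \<theta> \<le> d powr \<theta> / (1 - \<theta>)" "t powr \<theta> / (1 - \<theta>) \<le> d powr \<theta> / (1 - \<theta>)"
    proof -
      have "t powr \<theta> \<le> d powr \<theta>" using t assms by (intro powr_mono2) auto
      then show "t powr \<theta> / (1 - \<theta>) \<le> d powr \<theta> / (1 - \<theta>)"
        using assms by (simp add: divide_right_mono)
      have "d powr \<theta> * (1 - \<theta>) \<le> d powr \<theta>" using assms by (intro mult_left_le) auto
      then have "d powr \<theta> \<le> d powr \<theta> / (1 - \<theta>)" using assms by (simp add: field_simps)
      with \<open>t powr \<theta> \<le> d powr \<theta>\<close> show "t powr \<theta> \<le> d powr \<theta> / (1 - \<theta>)" by linarith
    qed
    have inc: "0 \<le> a * (ln b - ln a)" "a * (ln b - ln a) \<le> t"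
    proof -
      show "0 \<le> a * (ln b - ln a)" using le t by (cases "a = 0") auto
      show "a * (ln b - ln a) \<le> t"
      proof (cases "a = 0")
        case False
        with le have a: "a > 0" by simp
        have "ln b - ln a \<le> b / a - 1" using a t ln_le_minus_one[of "b / a"] by (simp add: ln_div)
        then have "a * (ln b - ln a) \<le> a * (b / a - 1)" using a by (intro mult_left_mono) auto
        also have "\<dots> = t" using a by (simp add: t_def field_simps)
        finally show ?thesis .
      qed (use t in simp)
    qed
    have eq: "b * ln b - a * ln a = t * ln b + a * (ln b - ln a)"
      by (simp add: t_def algebra_simps)
    have "t * ln b \<le> 0" using t le by (intro mult_nonneg_nonpos) auto
    then have "b * ln b - a * ln a \<le> t" using eq inc by linarith
    also have "t \<le> t powr \<theta>"
      using t assms powr_mono'[of \<theta> 1 t] by simp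
    finally have up: "b * ln b - a * ln a \<le> t powr \<theta>" .
    have "a * ln a - b * ln b \<le> t * (- ln t)"
    proof -
      have "t * ln t \<le> t * ln b" using t by (intro mult_left_mono) auto
      then show ?thesis using eq inc by simp
    qed
    \<comment> \<open>The exponent \<open>1 - \<theta>\<close> is chosen so that the extra factor
      \<open>t\<close> turns the bound into \<open>t powr \<theta>\<close>.\<close>
    also have "- ln t \<le> (1 / t) powr (1 - \<theta>) / (1 - \<theta>)"
      using t assms ln_powr_bound[of "1 / t" "1 - \<theta>"] by (simp add: ln_div)
    then have "t * (- ln t) \<le> t * ((1 / t) powr (1 - \<theta>) / (1 - \<theta>))"
      using t by (intro mult_left_mono) auto
    also have "\<dots> = t powr \<theta> / (1 - \<theta>)"
      using t by (simp add: powr_divide powr_diff)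
    finally show ?thesis using up tpow by linarith
  qed
qed

text \<open>The argument is a real function, not a PMF, so that empirical frequencies are covered
  too; nats keep \<open>ln 2\<close> out of the estimates.\<close>

definition nat_entropy :: "('a::finite \<Rightarrow> real) \<Rightarrow> real" where
  "nat_entropy f = - (\<Sum>a\<in>UNIV. f a * ln (f a))"

lemma abs_diff_nat_entropy_le:
  fixes f g :: "'a::finite \<Rightarrow> real"
  assumes "\<And>a. 0 \<le> f a" "\<And>a. f a \<le> 1" "\<And>a. 0 \<le> g a" "\<And>a. g a \<le> 1"
    and "\<And>a. \<bar>f a - g a\<bar> \<le> d" "d \<le> 1" "0 < \<theta>" "\<theta> < 1"
  shows "\<bar>nat_entropy f - nat_entropy g\<bar> \<le> real CARD('a) * (d powr \<theta> / (1 - \<theta>))"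
proof -
  have "\<bar>nat_entropy f - nat_entropy g\<bar> = \<bar>\<Sum>a\<in>UNIV. f a * ln (f a) - g a * ln (g a)\<bar>"
    by (simp add: nat_entropy_def sum_subtractf)
  also have "\<dots> \<le> (\<Sum>a\<in>(UNIV :: 'a set). d powr \<theta> / (1 - \<theta>))"
    using assms by (intro order.trans[OF sum_abs] sum_mono abs_diff_mult_ln_le)
  finally show ?thesis by simp
qed

section \<open>Mutual information and a lower bound on the LM rate\<close>

text \<open>This form isolates the joint entropy, the only term in which the members of
  \<open>LM_transitions\<close> differ, and it matches the three entropies that VSEE
  estimates.\<close>

lemma mutual_info_eq_nat_entropy:
  fixes p :: "'x::finite pmf" and w :: "'x \<Rightarrow> 'y::finite pmf"
  shows "mutual_info p w =
    (nat_entropy (pmf p) + nat_entropy (pmf (bind_pmf p w)) - nat_entropy (pmf (joint_pmf p w))) / ln 2"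
proof -
  let ?Q = "pmf (bind_pmf p w)"
  have eq: "pmf p x * pmf (w x) y * ln (pmf (w x) y / ?Q y) =
      pmf p x * pmf (w x) y * ln (pmf p x * pmf (w x) y) -
      pmf p x * ln (pmf p x) * pmf (w x) y - pmf p x * pmf (w x) y * ln (?Q y)" for x y
  proof (cases "pmf p x * pmf (w x) y = 0")
    case False
    then have pos: "pmf p x > 0" "pmf (w x) y > 0" by (auto simp: pmf_pos)
    \<comment> \<open>The output mass dominates the joint mass, so it is positive as well and the
      logarithm of the quotient splits.\<close>
    have "pmf p x * pmf (w x) y \<le> ?Q y"
      unfolding pmf_out by (rule member_le_sum) auto
    with pos have "?Q y > 0" by (metis less_le_trans mult_pos_pos)
    with pos show ?thesis by (simp add: ln_div ln_mult algebra_simps)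
  qed auto
  have "mutual_info p w = (\<Sum>x\<in>UNIV. \<Sum>y\<in>UNIV. pmf p x * pmf (w x) y * ln (pmf (w x) y / ?Q y)) / ln 2"
    by (simp add: mutual_info_eq log_def sum_divide_distrib)
  also have "(\<Sum>x\<in>UNIV. \<Sum>y\<in>UNIV. pmf p x * pmf (w x) y * ln (pmf (w x) y / ?Q y)) =
      (\<Sum>x\<in>UNIV. \<Sum>y\<in>UNIV. pmf p x * pmf (w x) y * ln (pmf p x * pmf (w x) y)) -
      (\<Sum>x\<in>UNIV. \<Sum>y\<in>UNIV. pmf p x * ln (pmf p x) * pmf (w x) y) -
      (\<Sum>x\<in>UNIV. \<Sum>y\<in>UNIV. pmf p x * pmf (w x) y * ln (?Q y))"
    by (simp only: eq sum_subtractf)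
  also have "(\<Sum>x\<in>UNIV. \<Sum>y\<in>UNIV. pmf p x * pmf (w x) y * ln (pmf p x * pmf (w x) y)) =
      - nat_entropy (pmf (joint_pmf p w))"
    by (simp add: nat_entropy_def sum.cartesian_product split_def flip: pmf_joint)
  also have "(\<Sum>x\<in>UNIV. \<Sum>y\<in>UNIV. pmf p x * ln (pmf p x) * pmf (w x) y) = - nat_entropy (pmf p)"
    by (simp add: nat_entropy_def sum_pmf_eq_1 flip: sum_distrib_left)
  also have "(\<Sum>x\<in>UNIV. \<Sum>y\<in>UNIV. pmf p x * pmf (w x) y * ln (?Q y)) =
      (\<Sum>y\<in>UNIV. \<Sum>x\<in>UNIV. pmf p x * pmf (w x) y * ln (?Q y))"
    by (rule sum.swap)
  also have "\<dots> = - nat_entropy ?Q"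
    by (simp add: nat_entropy_def pmf_out sum_distrib_right)
  finally show ?thesis by simp
qed

text \<open>Pointwise Gibbs inequality, from \<open>ln u \<le> u - 1\<close> at
  \<open>u = g / r\<close>. As \<open>g\<close> need not be normalised, summation leaves the excess
  of its mass over 1 as an error term.\<close>

lemma mult_ln_le_mult_ln_add_diff:
  fixes r g :: real
  assumes "0 \<le> r" "0 < g"
  shows "r * ln g \<le> r * ln r + (g - r)"
proof (cases "r = 0")
  case False
  with assms have r: "r > 0" by simp
  have "ln g - ln r \<le> g / r - 1" using r assms ln_le_minus_one[of "g / r"] by (simp add: ln_div)
  then have "r * (ln g - ln r) \<le> r * (g / r - 1)" using r by (intro mult_left_mono) auto
  also have "r * (g / r - 1) = g - r" using r by (simp add: field_simps)
  finally show ?thesis by (simp add: algebra_simps)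
qed (use assms in simp)

text \<open>The scale \<open>c\<close> is free: dividing the metric by it shifts both sides of the
  constraint in \<open>LM_transitions\<close> by the same amount. The loss is the excess of the
  total mass of \<open>k / c\<close> over 1.\<close>

lemma LM_rate_ge:
  fixes p :: "'x::finite pmf" and w :: "'x \<Rightarrow> 'y::finite pmf"
  assumes c: "c > 0" and k: "\<And>x y. k x y > 0"
    and dom: "\<And>x y. pmf (joint_pmf p w) (x, y) \<le> k x y / c"
  shows "LM_rate p w k \<ge> mutual_info p w - ((\<Sum>x\<in>UNIV. \<Sum>y\<in>UNIV. k x y / c) - 1) / ln 2"
proof -
  obtain v where v: "v \<in> LM_transitions p w k" and rate: "LM_rate p w k = mutual_info p v"
    using LM_rate_attained by blast
  define g where "g = (\<lambda>z. k (fst z) (snd z) / c)"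
  have g: "g z > 0" for z using c k by (simp add: g_def)
  have Q: "bind_pmf p v = bind_pmf p w" using v by (simp add: LM_transitions_def)
  have k0: "k x y \<noteq> 0" for x y using k[of x y] by simp
  have elm: "expected_log_metric p u k =
      ereal (((\<Sum>z\<in>UNIV. pmf (joint_pmf p u) z * ln (g z)) + ln c) / ln 2)" for u
  proof -
    have "(\<Sum>x\<in>UNIV. \<Sum>y\<in>UNIV. pmf p x * pmf (u x) y * log 2 (k x y)) =
        (\<Sum>z\<in>UNIV. pmf (joint_pmf p u) z * (ln (g z) + ln c) / ln 2)"
      using c k0 by (simp add: sum.cartesian_product split_def g_def pmf_joint[symmetric] log_def ln_div k)
    also have "\<dots> = ((\<Sum>z\<in>UNIV. pmf (joint_pmf p u) z * ln (g z)) + ln c) / ln 2"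
      by (simp add: distrib_left sum.distrib sum_pmf_eq_1 flip: sum_divide_distrib sum_distrib_right)
    finally show ?thesis using k0 by (simp add: expected_log_metric_eq)
  qed
  have "(\<Sum>z\<in>UNIV. pmf (joint_pmf p w) z * ln (pmf (joint_pmf p w) z))
      \<le> (\<Sum>z\<in>UNIV. pmf (joint_pmf p w) z * ln (g z))"
  proof (intro sum_mono)
    fix z
    show "pmf (joint_pmf p w) z * ln (pmf (joint_pmf p w) z) \<le> pmf (joint_pmf p w) z * ln (g z)"
    proof (cases "pmf (joint_pmf p w) z = 0")
      case False
      then have "0 < pmf (joint_pmf p w) z" by (simp add: pmf_pos)
      moreover have "pmf (joint_pmf p w) z \<le> g z"
        using dom[of "fst z" "snd z"] by (simp add: g_def)
      ultimately show ?thesis by (intro mult_left_mono) auto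
    qed simp
  qed
  \<comment> \<open>The constraint on \<open>v\<close>, with the common constant \<open>ln c\<close>
    cancelled.\<close>
  also have "\<dots> \<le> (\<Sum>z\<in>UNIV. pmf (joint_pmf p v) z * ln (g z))"
    using v by (simp add: LM_transitions_def elm divide_le_cancel)
  also have "\<dots> \<le> (\<Sum>z\<in>UNIV. pmf (joint_pmf p v) z * ln (pmf (joint_pmf p v) z) +
      (g z - pmf (joint_pmf p v) z))"
    by (intro sum_mono mult_ln_le_mult_ln_add_diff g) simp
  also have "\<dots> = - nat_entropy (pmf (joint_pmf p v)) + ((\<Sum>z\<in>UNIV. g z) - 1)"
    by (simp add: nat_entropy_def sum.distrib sum_subtractf sum_pmf_eq_1)
  also have "(\<Sum>z\<in>UNIV. g z) = (\<Sum>x\<in>UNIV. \<Sum>y\<in>UNIV. k x y / c)"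
    by (simp add: g_def sum.cartesian_product split_def)
  finally have "nat_entropy (pmf (joint_pmf p v)) \<le> nat_entropy (pmf (joint_pmf p w)) +
      ((\<Sum>x\<in>UNIV. \<Sum>y\<in>UNIV. k x y / c) - 1)"
    by (simp add: nat_entropy_def)
  \<comment> \<open>The two marginal entropies agree for \<open>v\<close> and \<open>w\<close>, so
    only the joint entropies are compared.\<close>
  then show ?thesis
    by (simp add: rate mutual_info_eq_nat_entropy Q flip: diff_divide_distrib)
      (simp add: divide_right_mono)
qed

section \<open>Empirical distributions and the entropy estimate\<close>

text \<open>On the empty list the division by zero yields 0, so \<open>empirical_nonneg\<close> and
  \<open>empirical_le_1\<close> hold for every list; only the total mass needs a non-empty
  one.\<close>

definition empirical :: "'a list \<Rightarrow> 'a \<Rightarrow> real" where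
  "empirical xs a = real (count_list xs a) / real (length xs)"

lemma empirical_nonneg: "0 \<le> empirical xs a"
  by (simp add: empirical_def)

lemma empirical_le_1: "empirical xs a \<le> 1"
  using count_le_length[of xs a] by (simp add: empirical_def divide_le_eq_1)

lemma sum_empirical:
  fixes xs :: "'a::finite list"
  assumes "xs \<noteq> []"
  shows "(\<Sum>a\<in>UNIV. empirical xs a) = 1"
  using assms sum_count_set[of xs UNIV]
  by (simp add: empirical_def flip: sum_divide_distrib of_nat_sum)

lemma H_MM_eq_nat_entropy:
  fixes xs :: "'a::finite list"
  shows "H_MM xs l = (nat_entropy (empirical xs) + (real l - 1) / (2 * real (length xs))) / ln 2"
proof -
  have "(\<Sum>a\<in>{a. count_list xs a > 0}.
      real (count_list xs a) / real (length xs) * log 2 (real (count_list xs a) / real (length xs))) =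
      (\<Sum>a\<in>UNIV. empirical xs a * ln (empirical xs a) / ln 2)"
    by (intro sum.mono_neutral_cong_left) (auto simp: empirical_def log_def)
  then show ?thesis
    by (simp only: H_MM_def nat_entropy_def)
      (simp add: log_def diff_divide_distrib sum_divide_distrib)
qed

text \<open>Makes the empirical distribution of the first components a marginal of that of the
  pairs, so that closeness of the pairs passes to the components.\<close>

lemma count_list_map_fst:
  fixes s :: "('x \<times> 'y::finite) list"
  shows "count_list (map fst s) x = (\<Sum>y\<in>UNIV. count_list s (x, y))"
proof (induction s)
  case (Cons z s)
  have "(\<Sum>y\<in>UNIV. count_list (z # s) (x, y)) =
      (\<Sum>y\<in>UNIV. count_list s (x, y) + (if y = snd z then (if fst z = x then 1 else 0) else 0))"
    by (intro sum.cong) (auto simp: prod_eq_iff)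
  then show ?case using Cons by (simp add: sum.distrib)
qed simp

lemma count_list_map_snd:
  fixes s :: "('x::finite \<times> 'y) list"
  shows "count_list (map snd s) y = (\<Sum>x\<in>UNIV. count_list s (x, y))"
proof (induction s)
  case (Cons z s)
  have "(\<Sum>x\<in>UNIV. count_list (z # s) (x, y)) =
      (\<Sum>x\<in>UNIV. count_list s (x, y) + (if x = fst z then (if snd z = y then 1 else 0) else 0))"
    by (intro sum.cong) (auto simp: prod_eq_iff)
  then show ?case using Cons by (simp add: sum.distrib)
qed simp

section \<open>Concentration of the empirical distribution\<close>

text \<open>Whether a draw equals \<open>z\<close> is a Bernoulli variable, and draws are
  independent. This gives access to Hoeffding's inequality for binomial distributions.\<close>

lemma map_pmf_count_list_replicate_pmf:
  "map_pmf (\<lambda>xs. count_list xs z) (replicate_pmf n q) = binomial_pmf n (pmf q z)"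
proof (induction n)
  case 0
  then show ?case by (simp add: binomial_pmf_0 pmf_le_1)
next
  case (Suc n)
  have bern: "bernoulli_pmf (pmf q z) = map_pmf (\<lambda>x. x = z) q"
  proof (rule pmf_eqI)
    fix b
    have "(\<lambda>x. x = z) -` {True} = {z}" "(\<lambda>x. x = z) -` {False} = UNIV - {z}" by auto
    then show "pmf (bernoulli_pmf (pmf q z)) b = pmf (map_pmf (\<lambda>x. x = z) q) b"
      using measure_pmf.prob_compl[of "{z}" q]
      by (cases b) (simp_all add: pmf_map pmf_le_1 measure_pmf_single)
  qed
  have "map_pmf (\<lambda>xs. count_list xs z) (replicate_pmf (Suc n) q) =
      bind_pmf q (\<lambda>x. map_pmf (\<lambda>c. c + (if x = z then 1 else 0))
        (map_pmf (\<lambda>xs. count_list xs z) (replicate_pmf n q)))"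
    by (simp add: map_bind_pmf map_pmf_def[symmetric] pmf.map_comp o_def)
      (auto simp: map_pmf_def bind_assoc_pmf bind_return_pmf intro!: bind_pmf_cong)
  also have "\<dots> = binomial_pmf (Suc n) (pmf q z)"
    unfolding Suc
    by (simp add: binomial_pmf_Suc pmf_le_1 bern map_pmf_def bind_assoc_pmf bind_return_pmf add.commute)
  finally show ?case .
qed

text \<open>Two-sided Hoeffding bound for each symbol, then a union bound. The result does not
  depend on \<open>q\<close>, which makes the final threshold uniform in \<open>p\<close> and
  \<open>w\<close>.\<close>

lemma prob_empirical_near:
  fixes q :: "'a::finite pmf"
  assumes "n > 0" "0 \<le> \<eta>"
  shows "measure_pmf.prob (replicate_pmf n q) {s. \<forall>z. \<bar>empirical s z - pmf q z\<bar> < \<eta>}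
    \<ge> 1 - 2 * real CARD('a) * exp (- 2 * real n * \<eta>\<^sup>2)"
proof -
  let ?M = "replicate_pmf n q"
  let ?B = "\<lambda>z. {s. \<bar>real (count_list s z) / real n - pmf q z\<bar> \<ge> \<eta>}"
  have B: "measure_pmf.prob ?M (?B z) \<le> 2 * exp (- 2 * real n * \<eta>\<^sup>2)" for z
  proof -
    interpret binomial_distribution n "pmf q z"
      by unfold_locales (simp add: pmf_le_1)
    have "measure_pmf.prob ?M (?B z) =
        measure_pmf.prob (map_pmf (\<lambda>s. count_list s z) ?M) {c. \<bar>real c / real n - pmf q z\<bar> \<ge> \<eta>}"
      by (simp add: vimage_def)
    then show ?thesis
      using prob_abs_ge'[of \<eta>] assms by (simp add: map_pmf_count_list_replicate_pmf)
  qed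
  have len: "length s = n" if "s \<in> set_pmf ?M" for s
    using that by (simp add: set_replicate_pmf)
  have "measure_pmf.prob ?M (\<Union>z. ?B z) \<le> (\<Sum>z\<in>UNIV. measure_pmf.prob ?M (?B z))"
    by (intro measure_pmf.finite_measure_subadditive_finite) auto
  also have "\<dots> \<le> (\<Sum>z\<in>(UNIV :: 'a set). 2 * exp (- 2 * real n * \<eta>\<^sup>2))"
    by (intro sum_mono B)
  finally have "measure_pmf.prob ?M (\<Union>z. ?B z) \<le> 2 * real CARD('a) * exp (- 2 * real n * \<eta>\<^sup>2)"
    by simp
  \<comment> \<open>\<open>empirical\<close> divides by the length of the list and \<open>?B\<close>
    by \<open>n\<close>; the two agree only on the support.\<close>
  moreover have "measure_pmf.prob ?M {s. \<forall>z. \<bar>empirical s z - pmf q z\<bar> < \<eta>} =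
      measure_pmf.prob ?M (UNIV - (\<Union>z. ?B z))"
    by (rule measure_eq_AE) (auto simp: AE_measure_pmf_iff empirical_def len not_le)
  ultimately show ?thesis
    using measure_pmf.prob_compl[of "\<Union>z. ?B z" ?M] by simp
qed

section \<open>The output of VSEE on samples close to the true distribution\<close>

lemma real_CARD_prod_ge:
  "real CARD('x::finite) \<le> real (CARD('x) * CARD('y::finite))"
  "real CARD('y) \<le> real (CARD('x) * CARD('y))"
  by (simp_all only: of_nat_le_iff) (simp_all add: Suc_leI)

text \<open>The term with \<open>(|X| - 1) (|Y| - 1)\<close> is the net Miller--Madow correction.\<close>

lemma VSEE_near:
  fixes p :: "'x::finite pmf" and w :: "'x \<Rightarrow> 'y::finite pmf" and s :: "('x \<times> 'y) list"
  defines "m \<equiv> real (CARD('x) * CARD('y))"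
  assumes s: "length s = n" "n > 0"
    and near: "\<And>z. \<bar>empirical s z - pmf (joint_pmf p w) z\<bar> \<le> \<eta>"
    and d: "m * \<eta> \<le> d" "d \<le> 1" and \<theta>: "0 < \<theta>" "\<theta> < 1"
  shows "\<bar>snd (VSEE \<alpha> \<beta> s) - (mutual_info p w
        - real ((CARD('x) - 1) * (CARD('y) - 1)) / (2 * real n * ln 2) - real n powr - \<beta>)\<bar>
    \<le> 3 * m * (d powr \<theta> / (1 - \<theta>)) / ln 2"
proof -
  let ?J = "joint_pmf p w" and ?e = "empirical s" and ?h = "d powr \<theta> / (1 - \<theta>)"
  have \<eta>: "0 \<le> \<eta>" using near[of undefined] by linarith
  have cx: "real CARD('x) \<le> m" "real CARD('y) \<le> m"
    unfolding m_def by (rule real_CARD_prod_ge)+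
  have m1: "1 \<le> m" using cx(1) by (simp add: order.trans[OF _ cx(1)] Suc_leI)
  have le_d: "\<eta> \<le> d" "real CARD('x) * \<eta> \<le> d" "real CARD('y) * \<eta> \<le> d"
    using d mult_right_mono[OF m1 \<eta>] mult_right_mono[OF cx(1) \<eta>] mult_right_mono[OF cx(2) \<eta>] by linarith+
  have h: "0 \<le> ?h" using \<theta> by simp
  have fst_emp: "empirical (map fst s) x = (\<Sum>y\<in>UNIV. ?e (x, y))" for x
    by (simp add: empirical_def count_list_map_fst sum_divide_distrib)
  have snd_emp: "empirical (map snd s) y = (\<Sum>x\<in>UNIV. ?e (x, y))" for y
    by (simp add: empirical_def count_list_map_snd sum_divide_distrib)
  \<comment> \<open>A marginal sums up to \<open>CARD('y)\<close> deviations; this is why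
    \<open>d\<close> must be at least \<open>m * \<eta>\<close> and not just
    \<open>\<eta>\<close>.\<close>
  have "\<bar>empirical (map fst s) x - pmf p x\<bar> \<le> d" for x
  proof -
    have "\<bar>empirical (map fst s) x - pmf p x\<bar> = \<bar>\<Sum>y\<in>UNIV. ?e (x, y) - pmf ?J (x, y)\<bar>"
      by (simp add: fst_emp sum_subtractf pmf_joint sum_pmf_eq_1 flip: sum_distrib_left)
    also have "\<dots> \<le> (\<Sum>y\<in>(UNIV :: 'y set). \<eta>)"
      by (intro order.trans[OF sum_abs] sum_mono near)
    finally show ?thesis using le_d by simp
  qed
  then have X: "\<bar>nat_entropy (empirical (map fst s)) - nat_entropy (pmf p)\<bar> \<le> real CARD('x) * ?h"
    using d \<theta> by (intro abs_diff_nat_entropy_le) (auto simp: empirical_nonneg empirical_le_1 pmf_le_1)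
  have "\<bar>empirical (map snd s) y - pmf (bind_pmf p w) y\<bar> \<le> d" for y
  proof -
    have "\<bar>empirical (map snd s) y - pmf (bind_pmf p w) y\<bar> = \<bar>\<Sum>x\<in>UNIV. ?e (x, y) - pmf ?J (x, y)\<bar>"
      by (simp add: snd_emp sum_subtractf pmf_joint pmf_out)
    also have "\<dots> \<le> (\<Sum>x\<in>(UNIV :: 'x set). \<eta>)"
      by (intro order.trans[OF sum_abs] sum_mono near)
    finally show ?thesis using le_d by simp
  qed
  then have Y: "\<bar>nat_entropy (empirical (map snd s)) - nat_entropy (pmf (bind_pmf p w))\<bar> \<le> real CARD('y) * ?h"
    using d \<theta> by (intro abs_diff_nat_entropy_le) (auto simp: empirical_nonneg empirical_le_1 pmf_le_1)
  have "\<bar>nat_entropy ?e - nat_entropy (pmf ?J)\<bar> \<le> real CARD('x \<times> 'y) * ?h"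
    using d \<theta> order.trans[OF near le_d(1)]
    by (intro abs_diff_nat_entropy_le) (auto simp: empirical_nonneg empirical_le_1 pmf_le_1)
  then have XY: "\<bar>nat_entropy ?e - nat_entropy (pmf ?J)\<bar> \<le> m * ?h"
    by (simp add: m_def)
  let ?\<Delta> = "(nat_entropy (empirical (map fst s)) - nat_entropy (pmf p)) +
      (nat_entropy (empirical (map snd s)) - nat_entropy (pmf (bind_pmf p w))) -
      (nat_entropy ?e - nat_entropy (pmf ?J))"
  have "real CARD('x) * ?h \<le> m * ?h" "real CARD('y) * ?h \<le> m * ?h"
    by (intro mult_right_mono cx h)+
  with X Y XY have "\<bar>?\<Delta>\<bar> \<le> 3 * (m * ?h)" by linarith
  then have "\<bar>?\<Delta>\<bar> / ln 2 \<le> 3 * (m * ?h) / ln 2" by (rule divide_right_mono) simp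
  moreover have "snd (VSEE \<alpha> \<beta> s) -
      (mutual_info p w - real ((CARD('x) - 1) * (CARD('y) - 1)) / (2 * real n * ln 2) - real n powr - \<beta>) = ?\<Delta> / ln 2"
  proof -
    \<comment> \<open>With \<open>a\<close> and \<open>b\<close> the alphabet sizes, the corrections
      add up by \<open>(a - 1) + (b - 1) - (a b - 1) = - (a - 1) (b - 1)\<close>. The subtractions
      on \<open>nat\<close> are exact as \<open>a, b \<ge> 1\<close>.\<close>
    have "real ((CARD('x) - 1) * (CARD('y) - 1)) = (real CARD('x) - 1) * (real CARD('y) - 1)"
      by (simp add: of_nat_diff Suc_leI)
    then show ?thesis
      using s by (simp add: VSEE_def Let_def H_MM_eq_nat_entropy mutual_info_eq_nat_entropy field_simps)
  qed
  ultimately show ?thesis by simp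
qed

text \<open>\<open>LM_rate_ge\<close> with \<open>c = n\<close>: the virtual samples raise each
  frequency by just the permitted deviation, and their total is the excess mass.\<close>

lemma LM_rate_VSEE_ge:
  fixes p :: "'x::finite pmf" and w :: "'x \<Rightarrow> 'y::finite pmf" and s :: "('x \<times> 'y) list"
  assumes s: "length s = n" "n > 0"
    and near: "\<And>z. \<bar>empirical s z - pmf (joint_pmf p w) z\<bar> \<le> real n powr (\<alpha> - 1)"
  shows "LM_rate p w (fst (VSEE \<alpha> \<beta> s)) \<ge>
    mutual_info p w - real (CARD('x) * CARD('y)) * real n powr (\<alpha> - 1) / ln 2"
proof -
  let ?k = "fst (VSEE \<alpha> \<beta> s)"
  have k: "?k x y / real n = empirical s (x, y) + real n powr (\<alpha> - 1)" for x y
    using s by (simp add: VSEE_def Let_def empirical_def powr_diff add_divide_distrib)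
  have "LM_rate p w ?k \<ge> mutual_info p w - ((\<Sum>x\<in>UNIV. \<Sum>y\<in>UNIV. ?k x y / real n) - 1) / ln 2"
  proof (rule LM_rate_ge)
    show "?k x y > 0" for x y
      using s by (simp add: VSEE_def Let_def add_nonneg_pos)
    show "pmf (joint_pmf p w) (x, y) \<le> ?k x y / real n" for x y
      using near[of "(x, y)"] unfolding k by linarith
  qed (use s in simp)
  moreover have "(\<Sum>x\<in>UNIV. \<Sum>y\<in>UNIV. empirical s (x, y)) = 1"
    using s sum_empirical[of s] by (auto simp: sum.cartesian_product)
  then have "(\<Sum>x\<in>UNIV. \<Sum>y\<in>UNIV. ?k x y / real n) - 1 = real (CARD('x) * CARD('y)) * real n powr (\<alpha> - 1)"
    unfolding k by (simp add: sum.distrib)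
  ultimately show ?thesis by simp
qed

section \<open>Choice of \<theta> and asymptotics of the errors\<close>

text \<open>In order, the four conditions make \<open>VSEE_near\<close> applicable with
  \<open>d = m * \<eta>\<close>, give the upper bound on the returned rate, give the lower bound,
  and bound the failure probability.\<close>

lemma eventually_VSEE_error_small:
  fixes \<alpha> \<beta> \<epsilon> \<delta> m C :: real
  assumes "\<alpha> > 1/2" "\<beta> > 0" "\<alpha> + \<beta> < 1" "\<epsilon> > 0" "\<delta> > 0" "m > 0"
  obtains \<theta> where "0 < \<theta>" "\<theta> < 1" "eventually (\<lambda>n. m * real n powr (\<alpha> - 1) \<le> 1 \<and>
      3 * m * ((m * real n powr (\<alpha> - 1)) powr \<theta> / (1 - \<theta>)) / ln 2 + m * real n powr (\<alpha> - 1) / ln 2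
        \<le> real n powr - \<beta> \<and>
      3 * m * ((m * real n powr (\<alpha> - 1)) powr \<theta> / (1 - \<theta>)) / ln 2 + C / (2 * real n * ln 2) + real n powr - \<beta> \<le> \<epsilon> \<and>
      2 * m * exp (- 2 * real n * (real n powr (\<alpha> - 1))\<^sup>2) < \<delta>) sequentially"
proof -
  \<comment> \<open>Here \<open>\<alpha> + \<beta> < 1\<close> leaves room for \<theta> below 1; by
    the choice of \<theta>, \<open>\<eta> powr \<theta>\<close> is
    \<open>o(n powr - \<beta>)\<close>.\<close>
  have pos: "\<beta> / (1 - \<alpha>) > 0" and "\<beta> / (1 - \<alpha>) < 1" using assms by auto
  from dense[OF this(2)] obtain \<theta> where less: "\<beta> / (1 - \<alpha>) < \<theta>" and "\<theta> < 1" by blast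
  with pos have \<theta>: "0 < \<theta>" "\<theta> < 1" by simp_all
  from less have \<gamma>: "\<beta> + (\<alpha> - 1) * \<theta> < 0" using assms by (simp add: field_simps)
  define A where "A = 3 * m * (m powr \<theta> / (1 - \<theta>)) / ln 2"
  have err: "3 * m * ((m * real n powr (\<alpha> - 1)) powr \<theta> / (1 - \<theta>)) / ln 2 = A * real n powr ((\<alpha> - 1) * \<theta>)" for n
    using assms by (simp add: A_def powr_mult powr_powr)
  have lim0: "((\<lambda>n. real n powr a) \<longlongrightarrow> 0) sequentially" if "a < 0" for a
    using tendsto_neg_powr[OF that filterlim_real_sequentially] .
  have at1: "(\<alpha> - 1) * \<theta> < 0" using assms \<theta> by (simp add: mult_neg_pos)
  have "((\<lambda>n. m * real n powr (\<alpha> - 1)) \<longlongrightarrow> m * 0) sequentially"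
    using assms by (intro tendsto_mult tendsto_const lim0) auto
  then have e1: "\<forall>\<^sub>F n in sequentially. m * real n powr (\<alpha> - 1) < 1"
    by (rule order_tendstoD(2)) simp
  \<comment> \<open>The second condition, divided by \<open>n powr - \<beta>\<close>.\<close>
  have "((\<lambda>n. A * real n powr (\<beta> + (\<alpha> - 1) * \<theta>) + m * real n powr (\<beta> + (\<alpha> - 1)) / ln 2)
      \<longlongrightarrow> A * 0 + m * 0 / ln 2) sequentially"
    using assms \<gamma> by (intro tendsto_intros lim0) auto
  then have e2: "\<forall>\<^sub>F n in sequentially. A * real n powr (\<beta> + (\<alpha> - 1) * \<theta>) + m * real n powr (\<beta> + (\<alpha> - 1)) / ln 2 < 1"
    by (rule order_tendstoD(2)) simp
  have "((\<lambda>n. A * real n powr ((\<alpha> - 1) * \<theta>) + C / (2 * ln 2) * inverse (real n) + real n powr - \<beta>)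
      \<longlongrightarrow> A * 0 + C / (2 * ln 2) * 0 + 0) sequentially"
    using assms at1 by (intro tendsto_intros lim0 lim_inverse_n) auto
  then have e3: "\<forall>\<^sub>F n in sequentially. A * real n powr ((\<alpha> - 1) * \<theta>) + C / (2 * ln 2) * inverse (real n) + real n powr - \<beta> < \<epsilon>"
    by (rule order_tendstoD(2)) (use assms in simp)
  \<comment> \<open>The Hoeffding exponent is
    \<open>n * \<eta>\<^sup>2 = n powr (2 * \<alpha> - 1)\<close> up to a factor; it diverges
    because \<open>\<alpha> > 1/2\<close>.\<close>
  have "filterlim (\<lambda>n. real n powr (2 * \<alpha> - 1)) at_top sequentially"
    using assms by (intro filterlim_compose[OF real_powr_at_top filterlim_real_sequentially]) simp
  then have "filterlim (\<lambda>n. - 2 * real n powr (2 * \<alpha> - 1)) at_bot sequentially"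
    by (intro filterlim_tendsto_neg_mult_at_bot[OF tendsto_const]) simp_all
  then have "((\<lambda>n. exp (- 2 * real n powr (2 * \<alpha> - 1))) \<longlongrightarrow> 0) sequentially"
    by (rule filterlim_compose[OF exp_at_bot])
  then have "((\<lambda>n. 2 * m * exp (- 2 * real n powr (2 * \<alpha> - 1))) \<longlongrightarrow> 2 * m * 0) sequentially"
    by (intro tendsto_intros)
  then have e4: "\<forall>\<^sub>F n in sequentially. 2 * m * exp (- 2 * real n powr (2 * \<alpha> - 1)) < \<delta>"
    by (rule order_tendstoD(2)) (use assms in simp)
  have "eventually (\<lambda>n. m * real n powr (\<alpha> - 1) \<le> 1 \<and>
      3 * m * ((m * real n powr (\<alpha> - 1)) powr \<theta> / (1 - \<theta>)) / ln 2 + m * real n powr (\<alpha> - 1) / ln 2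
        \<le> real n powr - \<beta> \<and>
      3 * m * ((m * real n powr (\<alpha> - 1)) powr \<theta> / (1 - \<theta>)) / ln 2 + C / (2 * real n * ln 2) + real n powr - \<beta> \<le> \<epsilon> \<and>
      2 * m * exp (- 2 * real n * (real n powr (\<alpha> - 1))\<^sup>2) < \<delta>) sequentially"
    using e1 e2 e3 e4 eventually_gt_at_top[of 0]
  proof eventually_elim
    case (elim n)
    have sq: "- 2 * real n * (real n powr (\<alpha> - 1))\<^sup>2 = - 2 * real n powr (2 * \<alpha> - 1)"
    proof -
      have "real n * (real n powr (\<alpha> - 1))\<^sup>2 = real n powr 1 * (real n powr (\<alpha> - 1) * real n powr (\<alpha> - 1))"
        using elim by (simp add: power2_eq_square)
      also have "\<dots> = real n powr (2 * \<alpha> - 1)"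
        by (simp only: powr_add[symmetric]) (simp add: algebra_simps)
      finally show ?thesis by simp
    qed
    have inv: "C / (2 * real n * ln 2) = C / (2 * ln 2) * inverse (real n)"
      by (simp add: field_simps)
    have "A * real n powr ((\<alpha> - 1) * \<theta>) + m * real n powr (\<alpha> - 1) / ln 2 =
        real n powr - \<beta> * (A * real n powr (\<beta> + (\<alpha> - 1) * \<theta>) + m * real n powr (\<beta> + (\<alpha> - 1)) / ln 2)"
    proof -
      have "real n powr - \<beta> * real n powr (\<beta> + a) = real n powr a" for a
        by (simp add: powr_add[symmetric])
      then show ?thesis by (simp add: distrib_left mult.left_commute)
    qed
    also have "\<dots> \<le> real n powr - \<beta>"
      using elim(2) by (intro mult_left_le) auto
    finally show ?case
      unfolding err sq inv using elim by (blast intro: less_imp_le)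
  qed
  with \<theta> show thesis by (rule that)
qed

section \<open>Guarantee on good samples and the uniform threshold\<close>

theorem theorem3:
  shows "\<exists>\<nu> :: real \<Rightarrow> real \<Rightarrow> real \<Rightarrow> real \<Rightarrow> nat.
    \<forall>\<alpha> \<beta> \<epsilon> \<delta> (p :: 'x::finite pmf) (w :: 'x \<Rightarrow> 'y::finite pmf) n.
      \<alpha> > 1/2 \<longrightarrow> \<beta> > 0 \<longrightarrow> \<alpha> + \<beta> < 1 \<longrightarrow> \<epsilon> > 0 \<longrightarrow> 0 < \<delta> \<longrightarrow> \<delta> < 1 \<longrightarrow>
      n > 0 \<longrightarrow> n \<ge> \<nu> \<alpha> \<beta> \<epsilon> \<delta> \<longrightarrow>
      measure_pmf.prob (replicate_pmf n (joint_pmf p w))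
        {S. let (K, R) = VSEE \<alpha> \<beta> S in mutual_info p w - \<epsilon> \<le> R \<and> R \<le> LM_rate p w K}
      > 1 - \<delta>"
proof -
  let ?good = "\<lambda>\<alpha> \<beta> \<epsilon> \<delta> n (p :: 'x pmf) (w :: 'x \<Rightarrow> 'y pmf).
      measure_pmf.prob (replicate_pmf n (joint_pmf p w))
        {S. let (K, R) = VSEE \<alpha> \<beta> S in mutual_info p w - \<epsilon> \<le> R \<and> R \<le> LM_rate p w K}
      > 1 - \<delta>"
  \<comment> \<open>\<open>p\<close> and \<open>w\<close> are quantified inside \<open>N\<close>, so
    the threshold depends only on the four parameters and the alphabets.\<close>
  have ex: "\<exists>N. \<forall>n\<ge>N. n > 0 \<longrightarrow> (\<forall>p w. ?good \<alpha> \<beta> \<epsilon> \<delta> n p w)"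
    if ab: "\<alpha> > 1/2" "\<beta> > 0" "\<alpha> + \<beta> < 1" "\<epsilon> > 0" "\<delta> > 0" for \<alpha> \<beta> \<epsilon> \<delta> :: real
  proof -
    define m where "m = real (CARD('x) * CARD('y))"
    define C where "C = real ((CARD('x) - 1) * (CARD('y) - 1))"
    have "m > 0" "C \<ge> 0" by (simp_all add: m_def C_def)
    obtain \<theta> where \<theta>: "0 < \<theta>" "\<theta> < 1" "eventually (\<lambda>n. m * real n powr (\<alpha> - 1) \<le> 1 \<and>
        3 * m * ((m * real n powr (\<alpha> - 1)) powr \<theta> / (1 - \<theta>)) / ln 2 + m * real n powr (\<alpha> - 1) / ln 2
          \<le> real n powr - \<beta> \<and>
        3 * m * ((m * real n powr (\<alpha> - 1)) powr \<theta> / (1 - \<theta>)) / ln 2 + C / (2 * real n * ln 2) + real n powr - \<beta> \<le> \<epsilon> \<and>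
        2 * m * exp (- 2 * real n * (real n powr (\<alpha> - 1))\<^sup>2) < \<delta>) sequentially"
      using eventually_VSEE_error_small[OF ab \<open>m > 0\<close>] by blast
    then obtain N where N: "\<And>n. n \<ge> N \<Longrightarrow> m * real n powr (\<alpha> - 1) \<le> 1"
      "\<And>n. n \<ge> N \<Longrightarrow> 3 * m * ((m * real n powr (\<alpha> - 1)) powr \<theta> / (1 - \<theta>)) / ln 2 + m * real n powr (\<alpha> - 1) / ln 2
          \<le> real n powr - \<beta>"
      "\<And>n. n \<ge> N \<Longrightarrow> 3 * m * ((m * real n powr (\<alpha> - 1)) powr \<theta> / (1 - \<theta>)) / ln 2 + C / (2 * real n * ln 2) + real n powr - \<beta> \<le> \<epsilon>"
      "\<And>n. n \<ge> N \<Longrightarrow> 2 * m * exp (- 2 * real n * (real n powr (\<alpha> - 1))\<^sup>2) < \<delta>"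
      by (auto simp: eventually_sequentially)
    have "?good \<alpha> \<beta> \<epsilon> \<delta> n p w" if n: "n \<ge> N" "n > 0" for n and p :: "'x pmf" and w :: "'x \<Rightarrow> 'y pmf"
    proof -
      let ?M = "replicate_pmf n (joint_pmf p w)" and ?\<eta> = "real n powr (\<alpha> - 1)"
      let ?near = "{s. \<forall>z. \<bar>empirical s z - pmf (joint_pmf p w) z\<bar> < ?\<eta>}"
      have "mutual_info p w - \<epsilon> \<le> snd (VSEE \<alpha> \<beta> s) \<and> snd (VSEE \<alpha> \<beta> s) \<le> LM_rate p w (fst (VSEE \<alpha> \<beta> s))"
        if s: "s \<in> set_pmf ?M" "s \<in> ?near" for s
      proof -
        have len: "length s = n" using s by (simp add: set_replicate_pmf)
        have near: "\<bar>empirical s z - pmf (joint_pmf p w) z\<bar> \<le> ?\<eta>" for z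
          using s(2) by (intro less_imp_le) blast
        \<comment> \<open>The correction only lowers the returned rate, so the upper bound may drop
          it; the lower bound pays for it within \<epsilon>.\<close>
        have "0 \<le> C / (2 * real n * ln 2)" using \<open>C \<ge> 0\<close> by simp
        moreover note VSEE_near[OF len n(2) near, of "m * ?\<eta>" \<theta> \<alpha> \<beta>, folded m_def C_def, OF order.refl N(1)[OF n(1)] \<theta>(1,2)]
          LM_rate_VSEE_ge[OF len n(2) near, of \<beta>, folded m_def] N(2,3)[OF n(1)]
        ultimately show ?thesis by linarith
      qed
      \<comment> \<open>The guarantee is known only for lists in the support, which have length
        \<open>n\<close>; hence monotonicity almost everywhere.\<close>
      then have "measure_pmf.prob ?M ?near \<le> measure_pmf.prob ?M
          {S. let (K, R) = VSEE \<alpha> \<beta> S in mutual_info p w - \<epsilon> \<le> R \<and> R \<le> LM_rate p w K}"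
        by (intro measure_pmf.finite_measure_mono_AE) (auto simp: AE_measure_pmf_iff split_def)
      moreover have "1 - 2 * m * exp (- 2 * real n * ?\<eta>\<^sup>2) \<le> measure_pmf.prob ?M ?near"
        using prob_empirical_near[OF n(2), of ?\<eta> "joint_pmf p w"] by (simp add: m_def)
      ultimately show ?thesis using N(4)[OF n(1)] by linarith
    qed
    then show ?thesis by blast
  qed
  \<comment> \<open>For parameters outside the admissible range the chosen value is
    arbitrary.\<close>
  define \<nu> where "\<nu> \<alpha> \<beta> \<epsilon> \<delta> = (SOME N. \<forall>n\<ge>N. n > 0 \<longrightarrow> (\<forall>p w. ?good \<alpha> \<beta> \<epsilon> \<delta> n p w))" for \<alpha> \<beta> \<epsilon> \<delta>
  have "\<forall>n\<ge>\<nu> \<alpha> \<beta> \<epsilon> \<delta>. n > 0 \<longrightarrow> (\<forall>p w. ?good \<alpha> \<beta> \<epsilon> \<delta> n p w)"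
    if "\<alpha> > 1/2" "\<beta> > 0" "\<alpha> + \<beta> < 1" "\<epsilon> > 0" "\<delta> > 0" for \<alpha> \<beta> \<epsilon> \<delta>
    unfolding \<nu>_def by (rule someI_ex[OF ex[OF that]])
  then show ?thesis by (intro exI[of _ \<nu>]) blast
qed

end
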